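(* Let $0<\alpha<1$ and let $p_1,\dots,p_n$ be $p$-values with arbitrary joint distribution, of which $n_0$ are null, and put $\pi_0=n_0/n$. Then the false discovery rate $\mathrm{FDR}$ of any multiple testing procedure that is compliant at level $\alpha$, applied to $p_1,\dots,p_n$, satisfies $$\mathrm{FDR}\;\le\;\pi_0\alpha+\pi_0\alpha\int_{\pi_0\alpha}^{1}\frac{\mathrm{FDR}_0(x)}{x^2}\,dx,$$ where $\mathrm{FDR}_0(x)$ denotes the false discovery rate of the BH procedure (not of the compliant procedure) at level $x$ applied to the $n_0$ null $p$-values only.
   Context: The $p$-values $p_1,\dots,p_n$ are random variables with values in $[0,1]$ on a common probability space. A fixed subset $\mathcal N_0\subset\{1,\dots,n\}$ of size $n_0\ge 1$ indexes the true null hypotheses; the corresponding $p$-values are called null $p$-values, and each of them is stochastically larger than or equal to the uniform variable on $(0,1)$. A multiple testing procedure (measurably) outputs a set of rejected $p$-values. With $R$ the number of rejections and $V$ the number of rejected null $p$-values, $\mathrm{FDR}=\mathbb E[V/\max\{R,1\}]$. The procedure is compliant at level $\alpha$ if every rejected $p$-value $p_j$ satisfies $p_j\le \alpha R/n$. BH procedure at level $x$ applied to $m$ $p$-values with order statistics $q_{(1)}\le\cdots\le q_{(m)}$: let $R=\max\{1\le j\le m: q_{(j)}\le xj/m\}$, with $\max\emptyset=0$, and reject the $R$ hypotheses with $p$-values at most $xR/m$ (none if $R=0$). $\mathrm{FDR}_0(x)$, $0<x<1$, is the FDR of this procedure applied to the $n_0$ null $p$-values alone, i.e. with $m=n_0$.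 *)

theory Defs
  imports "HOL-Probability.Probability"
begin

text \<open>
  Hypotheses are indexed by natural numbers; \<open>p i \<omega>\<close> is the realised value of the
  \<open>i\<close>-th p-value. The output of a multiple testing procedure is a random set of rejected
  indices, so that ties between p-values cause no ambiguity. It need not be a function of the
  p-values alone, so randomised procedures are covered as well.
\<close>

definition stoch_ge_uniform :: "'a measure \<Rightarrow> ('a \<Rightarrow> real) \<Rightarrow> bool" where
  "stoch_ge_uniform M X \<longleftrightarrow>
     (\<forall>t. measure M {\<omega> \<in> space M. X \<omega> > t} \<ge> measure (uniform_measure lborel {0<..<1}) {t<..})"

definition testing_procedure :: "'a measure \<Rightarrow> nat set \<Rightarrow> ('a \<Rightarrow> nat set) \<Rightarrow> bool" where
  "testing_procedure M I S \<longleftrightarrow> S \<in> measurable M (count_space (Pow I))"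

definition compliant ::
    "'a measure \<Rightarrow> nat \<Rightarrow> real \<Rightarrow> (nat \<Rightarrow> 'a \<Rightarrow> real) \<Rightarrow> ('a \<Rightarrow> nat set) \<Rightarrow> bool" where
  "compliant M n \<alpha> p S \<longleftrightarrow>
     (\<forall>\<omega>\<in>space M. \<forall>j\<in>S \<omega>. p j \<omega> \<le> \<alpha> * real (card (S \<omega>)) / real n)"

definition FDR :: "'a measure \<Rightarrow> nat set \<Rightarrow> ('a \<Rightarrow> nat set) \<Rightarrow> real" where
  "FDR M N S = (\<integral>\<omega>. real (card (S \<omega> \<inter> N)) / real (max (card (S \<omega>)) 1) \<partial>M)"

text \<open>The order statistics are numbered from 1, and repeated values are kept.\<close>

definition order_stat :: "nat set \<Rightarrow> (nat \<Rightarrow> real) \<Rightarrow> nat \<Rightarrow> real" where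
  "order_stat I q j = sorted_list_of_multiset (image_mset q (mset_set I)) ! (j - 1)"

definition BH_num :: "real \<Rightarrow> nat set \<Rightarrow> (nat \<Rightarrow> real) \<Rightarrow> nat" where
  "BH_num x I q =
     Max (insert 0 {j \<in> {1..card I}. order_stat I q j \<le> x * real j / real (card I)})"

definition BH_rejects :: "real \<Rightarrow> nat set \<Rightarrow> (nat \<Rightarrow> real) \<Rightarrow> nat set" where
  "BH_rejects x I q =
     (if BH_num x I q = 0 then {}
      else {i \<in> I. q i \<le> x * real (BH_num x I q) / real (card I)})"

definition FDR0 :: "'a measure \<Rightarrow> nat set \<Rightarrow> (nat \<Rightarrow> 'a \<Rightarrow> real) \<Rightarrow> real \<Rightarrow> real" where
  "FDR0 M N p x = FDR M N (\<lambda>\<omega>. BH_rejects x N (\<lambda>i. p i \<omega>))"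

end

theory Submission imports Defs begin

text \<open>
  Write \<open>c = \<pi>0 * \<alpha>\<close>. If a compliant procedure makes \<open>r\<close> rejections, \<open>v \<ge> 1\<close> of which are null,
  then \<open>v\<close> null p-values are at most \<open>\<alpha> * r / n\<close>, so BH on the null p-values rejects something at
  every level \<open>x \<ge> t\<close>, where \<open>t = c * r / v\<close>. As all its rejections are false, the false discovery
  proportion of BH is then 1. Integrating \<open>1 / x\<^sup>2\<close> from \<open>t\<close> to \<open>1\<close> bounds \<open>v / r = c / t\<close>
  pointwise by \<open>c\<close> plus \<open>c\<close> times the integral of the BH proportion divided by \<open>x\<^sup>2\<close>; Fubini's
  theorem then gives the bound in expectation.
\<close>

section \<open>Order statistics and rejections of the BH procedure\<close>

lemma sorted_nth_le_iff_filter: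
  fixes xs :: "'b::linorder list"
  assumes "sorted xs" "k < length xs"
  shows "xs ! k \<le> y \<longleftrightarrow> k < length (filter (\<lambda>x. x \<le> y) xs)"
  using assms
proof (induction xs arbitrary: k)
  case (Cons x xs)
  show ?case
  proof (cases "x \<le> y")
    case True
    with Cons show ?thesis by (cases k) auto
  next
    case False
    then have "\<forall>z\<in>set (x # xs). \<not> z \<le> y"
      using Cons.prems(1) by auto
    then have "\<not> (x # xs) ! k \<le> y" and "filter (\<lambda>z. z \<le> y) (x # xs) = []"
      using nth_mem[OF Cons.prems(2)] by (blast, simp)
    then show ?thesis by simp
  qed
qed simp

text \<open>The values at most \<open>y\<close> form a prefix of the sorted list, and its length is
  the count on the right. Order statistics start at 1 and list positions at 0, so position
  \<open>j - 1\<close> lies in the prefix exactly if \<open>j\<close> does not exceed that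
  length.\<close>

lemma order_stat_le_iff:
  assumes "finite I" "1 \<le> j" "j \<le> card I"
  shows "order_stat I q j \<le> y \<longleftrightarrow> j \<le> card {i \<in> I. q i \<le> y}"
proof -
  let ?xs = "sorted_list_of_multiset (image_mset q (mset_set I))"
  have len: "length ?xs = card I"
    by (metis mset_sorted_list_of_multiset size_image_mset size_mset size_mset_set)
  have "length (filter (\<lambda>x. x \<le> y) ?xs) = size (filter_mset (\<lambda>x. x \<le> y) (mset ?xs))"
    by (metis mset_filter size_mset)
  also have "\<dots> = card {i \<in> I. q i \<le> y}"
    using assms(1) by (simp add: filter_mset_image_mset filter_mset_mset_set)
  finally have "length (filter (\<lambda>x. x \<le> y) ?xs) = card {i \<in> I. q i \<le> y}" .
  then show ?thesis
    using sorted_nth_le_iff_filter[of ?xs "j - 1" y] assms len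
    by (auto simp: order_stat_def)
qed

text \<open>The maximum is positive as soon as some \<open>j\<close> has at least \<open>j\<close>
  p-values below its threshold, and such a \<open>j\<close> amounts to a set of that size. Without
  order statistics, joint measurability in outcome and level becomes visible, and a rejection can be
  proved by exhibiting a subset.\<close>

lemma BH_rejects_nonempty_iff:
  assumes "finite I"
  shows "BH_rejects x I q \<noteq> {} \<longleftrightarrow>
    (\<exists>A\<in>Pow I - {{}}. \<forall>i\<in>A. q i \<le> x * real (card A) / real (card I))"
proof -
  define J where "J = {j \<in> {1..card I}. order_stat I q j \<le> x * real j / real (card I)}"
  have J_iff: "j \<in> J \<longleftrightarrow> 1 \<le> j \<and> j \<le> card {i \<in> I. q i \<le> x * real j / real (card I)}" for j
  proof -
    have "card {i \<in> I. q i \<le> x * real j / real (card I)} \<le> card I"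
      using assms by (intro card_mono) auto
    then show ?thesis
      using order_stat_le_iff[OF assms] by (auto simp: J_def)
  qed
  have num: "BH_num x I q = Max (insert 0 J)"
    by (simp add: BH_num_def J_def)
  have finJ: "finite J" by (simp add: J_def)
  have *: "BH_rejects x I q \<noteq> {} \<longleftrightarrow> J \<noteq> {}"
  proof
    assume "J \<noteq> {}"
    then obtain j where "j \<in> J" by blast
    then have "1 \<le> j" "j \<le> BH_num x I q"
      using finJ by (auto simp: J_iff num)
    then have pos: "BH_num x I q \<noteq> 0" by simp
    \<comment> \<open>Being positive, the maximum is not the inserted default 0. Applying
      \<open>J_iff\<close> to it then bounds the number of rejections from below.\<close>
    then have "BH_num x I q \<in> J"
      using Max_in[of "insert 0 J"] finJ by (auto simp: num)
    then have "card (BH_rejects x I q) \<ge> 1"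
      using pos by (auto simp: J_iff BH_rejects_def)
    then show "BH_rejects x I q \<noteq> {}" by auto
  next
    assume "BH_rejects x I q \<noteq> {}"
    then have "BH_num x I q \<noteq> 0" by (auto simp: BH_rejects_def)
    then show "J \<noteq> {}" by (auto simp: num)
  qed
  show ?thesis
    unfolding *
  proof
    assume "J \<noteq> {}"
    then obtain j where "j \<in> J" by blast
    then have j: "1 \<le> j" "j \<le> card {i \<in> I. q i \<le> x * real j / real (card I)}"
      by (auto simp: J_iff)
    \<comment> \<open>Exactly \<open>j\<close> elements are kept, so that the threshold in terms of
      \<open>card A\<close> is the one for \<open>j\<close>. A larger set might fail, as
      \<open>x\<close> may be negative.\<close>
    then obtain A where A: "A \<subseteq> {i \<in> I. q i \<le> x * real j / real (card I)}" "card A = j"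
      by (meson obtain_subset_with_card_n)
    with j(1) show "\<exists>A\<in>Pow I - {{}}. \<forall>i\<in>A. q i \<le> x * real (card A) / real (card I)"
      by (intro bexI[of _ A]) auto
  next
    assume "\<exists>A\<in>Pow I - {{}}. \<forall>i\<in>A. q i \<le> x * real (card A) / real (card I)"
    then obtain A where A: "A \<subseteq> I" "A \<noteq> {}"
        "\<forall>i\<in>A. q i \<le> x * real (card A) / real (card I)" by auto
    have "card A \<le> card {i \<in> I. q i \<le> x * real (card A) / real (card I)}"
      using A assms by (intro card_mono) auto
    moreover have "1 \<le> card A"
      using A(1,2) assms by (simp add: Suc_le_eq card_gt_0_iff finite_subset)
    ultimately show "J \<noteq> {}" using J_iff by blast
  qed
qed

lemma FDR0_eq_integral_nonempty:
  assumes "finite N"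
  shows "FDR0 M N p x = (\<integral>\<omega>. of_bool (BH_rejects x N (\<lambda>i. p i \<omega>) \<noteq> {}) \<partial>M)"
proof -
  have "real (card (B \<inter> N)) / real (max (card B) 1) = of_bool (B \<noteq> {})"
    if "B \<subseteq> N" for B
  proof (cases "B = {}")
    case False
    with that assms have "card B \<noteq> 0" by (simp add: finite_subset)
    with False that show ?thesis by (simp add: Int_absorb2 max_def)
  qed simp
  moreover have "BH_rejects x N q \<subseteq> N" for q
    by (auto simp: BH_rejects_def)
  ultimately show ?thesis
    by (simp add: FDR0_def FDR_def)
qed

section \<open>Integration over the level, for a fixed outcome\<close>

lemma has_integral_inverse_square:
  fixes a b :: real
  assumes "0 < a" "a \<le> b"
  shows "((\<lambda>x. 1 / x\<^sup>2) has_integral 1 / a - 1 / b) {a..b}"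
proof -
  have "((\<lambda>x. 1 / x\<^sup>2) has_integral (- 1 / b) - (- 1 / a)) {a..b}"
  proof (rule fundamental_theorem_of_calculus[OF assms(2)])
    fix x assume "x \<in> {a..b}"
    with assms(1) have "x \<noteq> 0" by auto
    then show "((\<lambda>x. - 1 / x) has_vector_derivative 1 / x\<^sup>2) (at x within {a..b})"
      unfolding has_real_derivative_iff_has_vector_derivative[symmetric]
      by (auto intro!: derivative_eq_intros simp: power2_eq_square)
  qed
  then show ?thesis by simp
qed

lemma set_lebesgue_integral_inverse_square:
  fixes a b :: real
  assumes "0 < a" "a \<le> b"
  shows "set_integrable lborel {a..b} (\<lambda>x. 1 / x\<^sup>2)"
    and "(LBINT x:{a..b}. 1 / x\<^sup>2) = 1 / a - 1 / b"
proof -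
  have "continuous_on {a..b} (\<lambda>x. 1 / x\<^sup>2)"
    using assms by (intro continuous_intros) auto
  then show int: "set_integrable lborel {a..b} (\<lambda>x. 1 / x\<^sup>2)"
    by (rule borel_integrable_atLeastAtMost')
  show "(LBINT x:{a..b}. 1 / x\<^sup>2) = 1 / a - 1 / b"
    using set_borel_integral_eq_integral(2)[OF int] has_integral_inverse_square[OF assms]
    by (simp add: integral_unique)
qed

text \<open>Here \<open>B\<close> tells at which levels BH rejects. For \<open>t \<le> 1\<close>,
  keeping only the levels from \<open>t\<close> to 1 leaves \<open>1 / t - 1\<close>, and
  \<open>c + c * (1 / t - 1) = c / t\<close>. For \<open>t > 1\<close> the first summand alone
  suffices.\<close>

lemma linking_bound:
  fixes B :: "real \<Rightarrow> bool" and c t :: real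
  assumes "0 < c" "c < 1" "c \<le> t"
    and B: "\<And>x. t \<le> x \<Longrightarrow> B x"
    and int: "integrable lborel (\<lambda>x. indicator {c<..<1} x * (of_bool (B x) / x\<^sup>2))"
  shows "c / t \<le> c + c * (LBINT x. indicator {c<..<1} x * (of_bool (B x) / x\<^sup>2))"
proof (cases "t \<le> 1")
  case True
  have t: "0 < t" using assms by simp
  have "1 / t - 1 = (LBINT x. indicator {t..1} x * (1 / x\<^sup>2))"
    using set_lebesgue_integral_inverse_square(2)[OF t True]
    by (simp add: set_lebesgue_integral_def)
  also have "\<dots> \<le> (LBINT x. indicator {c<..<1} x * (of_bool (B x) / x\<^sup>2))"
  proof (rule integral_mono_AE)
    show "integrable lborel (\<lambda>x. indicator {t..1} x * (1 / x\<^sup>2))"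
      using set_lebesgue_integral_inverse_square(1)[OF t True]
      by (simp add: set_integrable_def)
    show "AE x in lborel. indicator {t..1} x * (1 / x\<^sup>2)
        \<le> indicator {c<..<1} x * (of_bool (B x) / x\<^sup>2)"
      \<comment> \<open>The closed interval can stick out of the open one only at the null points
        \<open>c\<close> (if \<open>t = c\<close>) and 1.\<close>
      using AE_lborel_singleton[of c] AE_lborel_singleton[of 1]
      by eventually_elim (use assms(3) B in \<open>auto simp: indicator_def\<close>)
  qed (rule int)
  finally have "c * (1 / t - 1) \<le> c * (LBINT x. indicator {c<..<1} x * (of_bool (B x) / x\<^sup>2))"
    using assms(1) by (intro mult_left_mono) auto
  then show ?thesis by (simp add: algebra_simps)
next
  case False
  then have "c / t \<le> c" using assms by (simp add: field_simps)
  moreover have "0 \<le> (LBINT x. indicator {c<..<1} x * (of_bool (B x) / x\<^sup>2))"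
    by (intro Bochner_Integration.integral_nonneg) auto
  ultimately show ?thesis
    using assms(1) by (smt (verit) mult_nonneg_nonneg)
qed

theorem theorem2:
  fixes M :: "'a measure" and n n0 :: nat and N0 :: "nat set" and \<alpha> \<pi>0 :: real
    and p :: "nat \<Rightarrow> 'a \<Rightarrow> real" and S :: "'a \<Rightarrow> nat set"
  assumes "prob_space M"
    and "0 < \<alpha>" and "\<alpha> < 1"
    and "\<And>i. i \<in> {1..n} \<Longrightarrow> p i \<in> borel_measurable M"
    and "\<And>i \<omega>. i \<in> {1..n} \<Longrightarrow> \<omega> \<in> space M \<Longrightarrow> p i \<omega> \<in> {0..1}"
    and "N0 \<subseteq> {1..n}" and "card N0 = n0" and "n0 \<ge> 1"
    and "\<And>i. i \<in> N0 \<Longrightarrow> stoch_ge_uniform M (p i)"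
    and "\<pi>0 = real n0 / real n"
    and "testing_procedure M {1..n} S"
    and "compliant M n \<alpha> p S"
  shows "FDR M N0 S \<le> \<pi>0 * \<alpha> + \<pi>0 * \<alpha> * (LBINT x=\<pi>0 * \<alpha>..1. FDR0 M N0 p x / x\<^sup>2)"
proof -
  interpret prob_space M by fact
  interpret L: pair_sigma_finite M lborel ..
  define c where "c = \<pi>0 * \<alpha>"
  have fin: "finite N0" using assms(6) finite_subset by blast
  have "n0 \<le> n" using card_mono[OF _ assms(6)] assms(7) by simp
  with assms(8) have n: "0 < n" by simp
  have pi0: "0 < \<pi>0" "\<pi>0 \<le> 1"
    using \<open>n0 \<le> n\<close> assms(8) n by (auto simp: assms(10))
  have c: "0 < c" "c < 1"
    using pi0 assms(2,3) by (simp add: c_def, smt (verit) c_def mult_left_le_one_le)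
  define B where "B \<omega> x \<longleftrightarrow> BH_rejects x N0 (\<lambda>i. p i \<omega>) \<noteq> {}" for \<omega> x
  \<comment> \<open>Integrating \<open>h\<close> over \<open>x\<close> gives the pointwise bound,
    integrating it over the outcome gives the integrand with \<open>FDR0\<close>.\<close>
  define h where "h \<omega> x = indicator {c<..<1} x * (of_bool (B \<omega> x) / x\<^sup>2)" for \<omega> and x :: real
  have p_meas [measurable]: "p i \<in> borel_measurable M" if "i \<in> N0" for i
    using assms(4,6) that by blast

  \<comment> \<open>Joint measurability and integrability on the product space\<close>
  have "(\<lambda>z. \<exists>A\<in>Pow N0 - {{}}. \<forall>i\<in>A. p i (fst z) \<le> snd z * real (card A) / real (card N0))
      \<in> measurable (M \<Otimes>\<^sub>M lborel) (count_space UNIV)"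
  proof (intro pred_intros_finite)
    fix A i assume "A \<in> Pow N0 - {{}}" "i \<in> A"
    then have [measurable]: "p i \<in> borel_measurable M" by (intro p_meas) auto
    show "(\<lambda>z. p i (fst z) \<le> snd z * real (card A) / real (card N0))
        \<in> measurable (M \<Otimes>\<^sub>M lborel) (count_space UNIV)"
      by measurable
  qed (use fin finite_subset in auto)
  \<comment> \<open>By the subset criterion, \<open>B\<close> is a finite Boolean combination of
    inequalities between measurable functions of outcome and level.\<close>
  then have [measurable]: "Measurable.pred (M \<Otimes>\<^sub>M lborel) (\<lambda>z. B (fst z) (snd z))"
    by (simp add: B_def BH_rejects_nonempty_iff[OF fin])
  have h_meas: "case_prod h \<in> borel_measurable (M \<Otimes>\<^sub>M lborel)"
    unfolding h_def case_prod_beta of_bool_def by measurable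
  \<comment> \<open>Since \<open>c > 0\<close>, the singularity of \<open>1 / x^2\<close> is
    avoided: \<open>h\<close> is at most the constant \<open>1 / c^2\<close> on a set of finite
    measure.\<close>
  have dom_int: "integrable (M \<Otimes>\<^sub>M lborel) (\<lambda>z. indicator (space M \<times> {c..1}) z * (1 / c\<^sup>2))"
  proof -
    have "emeasure (M \<Otimes>\<^sub>M lborel) (space M \<times> {c..1}) < \<infinity>"
      using c by (simp add: lborel.emeasure_pair_measure_Times emeasure_space_1)
    moreover have "space M \<times> {c..1} \<in> sets (M \<Otimes>\<^sub>M lborel)"
      by (intro pair_measureI) auto
    ultimately show ?thesis by (intro integrable_mult_left integrable_real_indicator)
  qed
  have h_int: "integrable (M \<Otimes>\<^sub>M lborel) (case_prod h)"
  proof (rule Bochner_Integration.integrable_bound[OF dom_int h_meas], rule AE_I2)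
    fix z :: "'a \<times> real" assume "z \<in> space (M \<Otimes>\<^sub>M lborel)"
    then have z: "fst z \<in> space M" by (auto simp: space_pair_measure)
    have "1 / (snd z)\<^sup>2 \<le> 1 / c\<^sup>2" if "c < snd z"
      using that c by (intro divide_left_mono power_mono) auto
    then show "norm (case_prod h z) \<le> norm (indicator (space M \<times> {c..1}) z * (1 / c\<^sup>2))"
      using z by (auto simp: h_def case_prod_beta indicator_def mem_Times_iff)
  qed

  \<comment> \<open>The bound for a single outcome\<close>
  have S_meas: "S \<in> measurable M (count_space (Pow {1..n}))"
    using assms(11) by (simp add: testing_procedure_def)
  have S_fin: "finite (S \<omega>)" if "\<omega> \<in> space M" for \<omega>
    using measurable_space[OF S_meas that] finite_subset by auto
  have pointwise: "real (card (S \<omega> \<inter> N0)) / real (max (card (S \<omega>)) 1)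
      \<le> c + c * (LBINT x. h \<omega> x)"
    if \<omega>: "\<omega> \<in> space M" and h\<omega>: "integrable lborel (h \<omega>)" for \<omega>
  proof (cases "S \<omega> \<inter> N0 = {}")
    case True
    have "0 \<le> (LBINT x. h \<omega> x)"
      by (intro Bochner_Integration.integral_nonneg) (auto simp: h_def)
    then show ?thesis using True c by simp
  next
    case False
    define v r where "v = card (S \<omega> \<inter> N0)" and "r = card (S \<omega>)"
    have v: "1 \<le> v" "v \<le> r"
      using False S_fin[OF \<omega>]
      by (auto simp: v_def r_def Suc_le_eq card_gt_0_iff intro: card_mono)
    \<comment> \<open>At this level the BH threshold for \<open>v\<close> of the \<open>n0\<close>
      null p-values, \<open>t * v / n0\<close>, equals the compliance threshold
      \<open>\<alpha> * r / n\<close>.\<close>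
    define t where "t = c * r / v"
    have "c \<le> t" using v c by (simp add: t_def field_simps)
    moreover have "B \<omega> x" if "t \<le> x" for x
      unfolding B_def BH_rejects_nonempty_iff[OF fin]
    proof (intro bexI[of _ "S \<omega> \<inter> N0"] ballI)
      fix i assume "i \<in> S \<omega> \<inter> N0"
      then have "p i \<omega> \<le> \<alpha> * real r / real n"
        using assms(12) \<omega> by (auto simp: compliant_def r_def)
      also have "\<dots> = t * v / n0"
        using v assms(8) by (simp add: t_def c_def assms(10))
      also have "\<dots> \<le> x * v / n0"
        using that by (intro divide_right_mono mult_right_mono) auto
      finally show "p i \<omega> \<le> x * real (card (S \<omega> \<inter> N0)) / real (card N0)"
        by (simp add: v_def assms(7))
    qed (use False in auto)
    ultimately have "c / t \<le> c + c * (LBINT x. h \<omega> x)"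
      using linking_bound[OF c, of t "B \<omega>"] h\<omega> by (simp add: h_def[abs_def])
    moreover have "c / t = v / r" using c v by (simp add: t_def)
    ultimately show ?thesis using v by (simp add: v_def r_def)
  qed

  \<comment> \<open>Passage to expectations\<close>
  have fdp_meas: "(\<lambda>\<omega>. real (card (S \<omega> \<inter> N0)) / real (max (card (S \<omega>)) 1)) \<in> borel_measurable M"
    by (rule measurable_compose[OF S_meas]) simp
  have "FDR M N0 S \<le> (\<integral>\<omega>. c + c * (LBINT x. h \<omega> x) \<partial>M)"
    unfolding FDR_def
  proof (rule integral_mono_AE)
    show "integrable M (\<lambda>\<omega>. real (card (S \<omega> \<inter> N0)) / real (max (card (S \<omega>)) 1))"
    proof (rule integrable_const_bound[OF _ fdp_meas, of 1], rule AE_I2)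
      fix \<omega> assume "\<omega> \<in> space M"
      then have "card (S \<omega> \<inter> N0) \<le> card (S \<omega>)"
        by (intro card_mono S_fin) auto
      then show "norm (real (card (S \<omega> \<inter> N0)) / real (max (card (S \<omega>)) 1)) \<le> 1"
        by simp
    qed
    show "integrable M (\<lambda>\<omega>. c + c * (LBINT x. h \<omega> x))"
      using L.integrable_fst[OF h_int] by simp
    \<comment> \<open>Fubini makes the section \<open>h \<omega>\<close> integrable only for almost
      every outcome, hence the integrability premise in \<open>pointwise\<close> and the
      almost-everywhere comparison.\<close>
    show "AE \<omega> in M. real (card (S \<omega> \<inter> N0)) / real (max (card (S \<omega>)) 1)
        \<le> c + c * (LBINT x. h \<omega> x)"
      using L.AE_integrable_fst[OF h_int] AE_space
      by eventually_elim (rule pointwise)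
  qed
  also have "\<dots> = c + c * (\<integral>\<omega>. (LBINT x. h \<omega> x) \<partial>M)"
    using L.integrable_fst[OF h_int] by (simp add: prob_space)
  also have "(\<integral>\<omega>. (LBINT x. h \<omega> x) \<partial>M) = (LBINT x. (\<integral>\<omega>. h \<omega> x \<partial>M))"
    using L.Fubini_integral[OF h_int] by simp
  also have "\<dots> = (LBINT x. indicator {c<..<1} x * (FDR0 M N0 p x / x\<^sup>2))"
    by (simp add: h_def B_def FDR0_eq_integral_nonempty[OF fin])
  \<comment> \<open>For \<open>c \<le> 1\<close> the interval integral is the one over the open
    interval, which is why \<open>h\<close> uses \<open>{c<..<1}\<close>.\<close>
  also have "\<dots> = (LBINT x=c..1. FDR0 M N0 p x / x\<^sup>2)"
    using c by (simp add: interval_lebesgue_integral_def set_lebesgue_integral_def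
        einterval_eq one_ereal_def)
  finally show ?thesis by (simp add: c_def)
qed

end
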